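(* Let $\alpha\in\,]0,\frac{\pi}{3}[$ with $\alpha=\frac{2\pi}{n}$, $n$ a positive integer, and consider the 2-point binary non-stationary subdivision scheme defined, for $k\ge 0$ and $i\in\mathbb{Z}$, by $$f^{k+1}_{2i}=a_{0}^{(k)}f^{k}_{i}+a_{1}^{(k)}f^{k}_{i+1},\qquad f^{k+1}_{2i+1}=a_{1}^{(k)}f^{k}_{i}+a_{0}^{(k)}f^{k}_{i+1},$$ where $$a^{(k)}_{0}=\frac{\sin\frac{3\alpha}{2^{k+2}}}{\sin\frac{\alpha}{2^{k}}},\qquad a^{(k)}_{1}=\frac{\sin\frac{\alpha}{2^{k+2}}}{\sin\frac{\alpha}{2^{k}}}.$$ The limit curves of this scheme reproduce the functions $\cos(\alpha\,\cdot)$ and $\sin(\alpha\,\cdot)$ for the data points $f_i^k=\cos\left(\left(i-\tfrac12\right)\frac{\alpha}{2^k}\right)$ and $f_i^k=\sin\left(\left(i-\tfrac12\right)\frac{\alpha}{2^k}\right)$, respectively. In other words, for every $k\ge 0$: (i) if $f_i^k=\cos\left(\left(i-\tfrac12\right)\frac{\alpha}{2^k}\right)$, then for $0\le i\le 2^k n$ $$f_{2i}^{k+1}=\cos\left(2i\,\frac{\alpha}{2^{k+1}}\right)\quad\text{and}\quad f_{2i+1}^{k+1}=\cos\left((2i+1)\frac{\alpha}{2^{k+1}}\right);$$ (ii) similarly, if $f_i^k=\sin\left(\left(i-\tfrac12\right)\frac{\alpha}{2^k}\right)$, then for $0\le i\le 2^k n$ $$f_{2i}^{k+1}=\sin\left(2i\,\frac{\alpha}{2^{k+1}}\right)\quad\text{and}\quad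 f_{2i+1}^{k+1}=\sin\left((2i+1)\frac{\alpha}{2^{k+1}}\right).$$
   Context: Starting from initial data $f^0=\{f^0_i\}_{i\in\mathbb{Z}}$ of real numbers, the scheme produces the data $f^{k+1}=\{f^{k+1}_i\}_{i\in\mathbb{Z}}$ from $f^k=\{f^k_i\}_{i\in\mathbb{Z}}$ for $k=0,1,2,\dots$. The limit function (limit curve) for initial data $f^0$ is the continuous function $g:\mathbb{R}\to\mathbb{R}$ with $\lim_{k\to\infty}\sup_{i\in\mathbb{Z}}|f_i^k-g(2^{-k}i)|=0$. Here $\cos(\alpha\,\cdot)$ and $\sin(\alpha\,\cdot)$ denote the functions $x\mapsto\cos(\alpha x)$ and $x\mapsto\sin(\alpha x)$.
   Formalization: The formulas printed in (i), (ii) are false (at i=0 the scheme gives f_0^{k+1}=cos(α/2^{k+2})≠1); the formal version has cos/sin((j−1/2)α/2^{k+1}) for j=2i, 2i+1 in place of cos/sin(jα/2^{k+1}). *)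

theory Defs
  imports "HOL-Analysis.Analysis"
begin

definition mask0 :: "real \<Rightarrow> nat \<Rightarrow> real" where
  "mask0 \<alpha> k = sin (3 * \<alpha> / 2 ^ (k + 2)) / sin (\<alpha> / 2 ^ k)"

definition mask1 :: "real \<Rightarrow> nat \<Rightarrow> real" where
  "mask1 \<alpha> k = sin (\<alpha> / 2 ^ (k + 2)) / sin (\<alpha> / 2 ^ k)"

(* Index i at level k samples a curve at parameter (i - 1/2) / 2 ^ k, whereas the
   limit curve is read off at i / 2 ^ k. The offset is preserved by refinement:
   since sin (3 t) cos (y - 2 t) + sin t cos (y + 2 t) = sin (4 t) cos (y - t),
   samples of cos at (i - 1/2) \<alpha> / 2 ^ k become samples at
   (j - 1/2) \<alpha> / 2 ^ (k + 1), not at j \<alpha> / 2 ^ (k + 1); the offset only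
   disappears in the limit. *)
definition subdivision_data :: "real \<Rightarrow> (nat \<Rightarrow> int \<Rightarrow> real) \<Rightarrow> bool" where
  "subdivision_data \<alpha> f \<longleftrightarrow>
     (\<forall>k i. f (Suc k) (2 * i) = mask0 \<alpha> k * f k i + mask1 \<alpha> k * f k (i + 1) \<and>
            f (Suc k) (2 * i + 1) = mask1 \<alpha> k * f k i + mask0 \<alpha> k * f k (i + 1))"

(* The supremum is taken in ereal, so that it is infinite when the differences
   are unbounded; the real-valued Sup of an unbounded set is unspecified. *)
definition limit_curve :: "(nat \<Rightarrow> int \<Rightarrow> real) \<Rightarrow> (real \<Rightarrow> real) \<Rightarrow> bool" where
  "limit_curve f g \<longleftrightarrow> continuous_on UNIV g \<and>
     (\<lambda>k. SUP i. ereal \<bar>f k i - g (of_int i / 2 ^ k)\<bar>) \<longlonglongrightarrow> 0"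

lemma limit_curve_unique:
  assumes "limit_curve f g" "limit_curve f h"
  shows "g = h"
proof
  fix x :: real
  define j where "j k = \<lfloor>2 ^ k * x\<rfloor>" for k :: nat
  define y :: "nat \<Rightarrow> real" where "y k = of_int (j k) / 2 ^ k" for k
  have y_lim: "y \<longlonglongrightarrow> x"
  proof (rule real_tendsto_sandwich)
    show "\<forall>\<^sub>F k in sequentially. x - (1/2) ^ k \<le> y k"
      proof (rule always_eventually, rule allI)
      fix k
      have "2 ^ k * x - 1 \<le> of_int (j k)" unfolding j_def by linarith
      then have "(2 ^ k * x - 1) / 2 ^ k \<le> y k"
        unfolding y_def by (intro divide_right_mono) auto
      then show "x - (1/2) ^ k \<le> y k" by (simp add: diff_divide_distrib power_one_over)
    qed
    show "\<forall>\<^sub>F k in sequentially. y k \<le> x"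
      proof (rule always_eventually, rule allI)
      fix k
      have "of_int (j k) \<le> 2 ^ k * x" unfolding j_def by linarith
      then show "y k \<le> x" by (simp add: y_def field_simps)
    qed
    have "(\<lambda>k. x - (1/2) ^ k) \<longlonglongrightarrow> x - 0" 
      by (intro tendsto_intros LIMSEQ_power_zero) auto
    then show "(\<lambda>k. x - (1/2) ^ k) \<longlonglongrightarrow> x" by simp
  qed auto
  have *: "(\<lambda>k. f k (j k)) \<longlonglongrightarrow> u x" if u: "limit_curve f u" for u
  proof -
    have "(\<lambda>k. ereal \<bar>f k (j k) - u (y k)\<bar>) \<longlonglongrightarrow> 0"
    proof (rule tendsto_sandwich[OF _ _ tendsto_const])
      show "(\<lambda>k. SUP i. ereal \<bar>f k i - u (of_int i / 2 ^ k)\<bar>) \<longlonglongrightarrow> 0"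
        using u by (simp add: limit_curve_def)
    qed (auto intro!: always_eventually SUP_upper simp: y_def)
    then have "(\<lambda>k. f k (j k) - u (y k)) \<longlonglongrightarrow> 0"
      by (simp add: zero_ereal_def tendsto_rabs_zero_iff)
    moreover have "(\<lambda>k. u (y k)) \<longlonglongrightarrow> u x"
      using u y_lim by (auto simp: limit_curve_def continuous_on_eq_continuous_at
        intro: isCont_tendsto_compose)
    ultimately show ?thesis using tendsto_add by fastforce
  qed
  show "g x = h x"
    using LIMSEQ_unique[OF *[OF assms(1)] *[OF assms(2)]] .
qed

end

theory Submission
  imports Defs
begin

text \<open>One refinement step maps the samples of \<open>cos (\<cdot> + p)\<close> at the points
  \<open>(i - 1/2) \<alpha> / 2\<^sup>k\<close> to those at \<open>(j - 1/2) \<alpha> / 2\<^sup>k\<^sup>+\<^sup>1\<close>, by product-to-sum formulas. Hence all later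
  levels consist of such samples, which are within \<open>\<alpha> / 2\<^sup>m\<^sup>+\<^sup>1\<close> of the curve at \<open>i / 2\<^sup>m\<close> because
  cosine is 1-Lipschitz. The phases \<open>p = 0\<close> and \<open>p = - pi / 2\<close> give cosine and sine.\<close>

lemma sin_cos_refinement:
  fixes t y :: real
  shows "sin (3 * t) * cos (y - 2 * t) + sin t * cos (y + 2 * t) = sin (4 * t) * cos (y - t)"
proof -
  \<comment> \<open>The product-to-sum formulas produce four sines. These two cancel, and the other
    two, of \<open>y + 3 * t\<close> and \<open>5 * t - y\<close>, are the expansion of the
    right-hand side.\<close>
  have "sin (- t - y) = - sin (y + t)"
    using sin_minus[of "y + t"] by (simp add: algebra_simps)
  then show ?thesis
    unfolding sin_times_cos by (simp add: field_simps)
qed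

lemma abs_cos_diff_le:
  fixes x y :: real
  shows "\<bar>cos x - cos y\<bar> \<le> \<bar>x - y\<bar>"
proof -
  have "\<bar>cos x - cos y\<bar> = 2 * \<bar>sin ((x + y) / 2)\<bar> * \<bar>sin ((y - x) / 2)\<bar>"
    by (simp add: cos_diff_cos abs_mult)
  also have "\<dots> \<le> 2 * 1 * \<bar>(y - x) / 2\<bar>"
    by (intro mult_mono abs_sin_x_le_abs_x) auto
  finally show ?thesis by simp
qed

lemma subdivision_data_cos_step:
  assumes "0 < \<alpha>" "\<alpha> < pi" "subdivision_data \<alpha> f"
    and f: "\<And>i. f k i = cos ((of_int i - 1 / 2) * (\<alpha> / 2 ^ k) + p)"
  shows "f (Suc k) j = cos ((of_int j - 1 / 2) * (\<alpha> / 2 ^ Suc k) + p)"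
proof -
  \<comment> \<open>A quarter of the spacing at level \<open>k\<close>: every angle in the masks
    becomes an integer multiple of \<open>t\<close>.\<close>
  define t where "t = \<alpha> / 2 ^ (k + 2)"
  have t: "\<alpha> / 2 ^ k = 4 * t" "3 * \<alpha> / 2 ^ (k + 2) = 3 * t" "\<alpha> / 2 ^ Suc k = 2 * t"
    by (simp_all add: t_def field_simps)
  \<comment> \<open>This keeps \<open>4 * t\<close> strictly between 0 and \<open>pi\<close>, so the
    common denominator of the masks does not vanish.\<close>
  have "\<alpha> / 2 ^ k \<le> \<alpha>"
    using \<open>0 < \<alpha>\<close> by (simp add: field_simps)
  then have "0 < 4 * t" "4 * t < pi"
    using \<open>0 < \<alpha>\<close> \<open>\<alpha> < pi\<close> by (simp_all flip: t(1))
  then have nz: "sin (4 * t) \<noteq> 0"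
    using sin_gt_zero[of "4 * t"] by simp
  have mask: "mask0 \<alpha> k = sin (3 * t) / sin (4 * t)" "mask1 \<alpha> k = sin t / sin (4 * t)"
    unfolding mask0_def mask1_def t by (simp_all add: t_def)
  define i where "i = j div 2"
  \<comment> \<open>The midpoint of the two parent angles \<open>y - 2 * t\<close> and
    \<open>y + 2 * t\<close>; the two children sit at \<open>y - t\<close> and
    \<open>y + t\<close>.\<close>
  define y where "y = 4 * t * of_int i + p"
  have fi: "f k i = cos (y - 2 * t)" "f k (i + 1) = cos (y + 2 * t)"
    unfolding f t by (simp_all add: y_def algebra_simps)
  show ?thesis
  proof (cases "even j")
    case True
    then have j: "j = 2 * i" by (simp add: i_def)
    have "f (Suc k) j = mask0 \<alpha> k * f k i + mask1 \<alpha> k * f k (i + 1)"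
      using assms(3) by (simp add: subdivision_data_def j)
    also have "\<dots> = (sin (3 * t) * cos (y - 2 * t) + sin t * cos (y + 2 * t)) / sin (4 * t)"
      by (simp add: mask fi add_divide_distrib)
    also have "\<dots> = cos (y - t)"
      using nz by (simp add: sin_cos_refinement)
    finally show ?thesis
      unfolding t by (simp add: y_def j algebra_simps)
  next
    case False
    then have j: "j = 2 * i + 1" by (simp add: i_def)
    have "f (Suc k) j = mask1 \<alpha> k * f k i + mask0 \<alpha> k * f k (i + 1)"
      using assms(3) by (simp add: subdivision_data_def j)
    \<comment> \<open>The odd rule mirrors the even one: cosine is even, so replacing
      \<open>y\<close> by \<open>- y\<close> swaps the two parents and the same identity
      applies.\<close>
    also have "\<dots> = (sin (3 * t) * cos (- y - 2 * t) + sin t * cos (- y + 2 * t)) / sin (4 * t)"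
      using cos_minus[of "y + 2 * t"] cos_minus[of "y - 2 * t"]
      by (simp add: mask fi add_divide_distrib)
    also have "\<dots> = cos (y + t)"
      unfolding sin_cos_refinement using nz cos_minus[of "y + t"] by simp
    finally show ?thesis
      unfolding t by (simp add: y_def j algebra_simps)
  qed
qed

lemma subdivision_data_cos:
  assumes "0 < \<alpha>" "\<alpha> < pi" "subdivision_data \<alpha> f"
    and "\<And>i. f k i = cos ((of_int i - 1 / 2) * (\<alpha> / 2 ^ k) + p)" and "k \<le> m"
  shows "f m i = cos ((of_int i - 1 / 2) * (\<alpha> / 2 ^ m) + p)"
  using \<open>k \<le> m\<close>
proof (induction m arbitrary: i rule: dec_induct)
  case base
  show ?case by fact
next
  case (step m)
  show ?case
    by (rule subdivision_data_cos_step[OF assms(1-3) step.IH])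
qed

text \<open>The samples are known from level \<open>k\<close> on, which suffices because a limit
  ignores finitely many levels. A bound uniform in \<open>i\<close> passes to the supremum and tends
  to 0.\<close>

lemma limit_curve_cos:
  assumes "0 < \<alpha>" "\<alpha> < pi" "subdivision_data \<alpha> f"
    and "\<And>i. f k i = cos ((of_int i - 1 / 2) * (\<alpha> / 2 ^ k) + p)"
  shows "limit_curve f (\<lambda>x. cos (\<alpha> * x + p))"
  unfolding limit_curve_def
proof
  show "continuous_on UNIV (\<lambda>x. cos (\<alpha> * x + p))"
    by (intro continuous_intros)
  let ?S = "\<lambda>m. SUP i. ereal \<bar>f m i - cos (\<alpha> * (of_int i / 2 ^ m) + p)\<bar>"
  have dist: "\<bar>f m i - cos (\<alpha> * (of_int i / 2 ^ m) + p)\<bar> \<le> \<alpha> * (1 / 2) ^ m" if "k \<le> m" for m i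
  proof -
    have "\<bar>f m i - cos (\<alpha> * (of_int i / 2 ^ m) + p)\<bar>
        \<le> \<bar>((of_int i - 1 / 2) * (\<alpha> / 2 ^ m) + p) - (\<alpha> * (of_int i / 2 ^ m) + p)\<bar>"
      unfolding subdivision_data_cos[OF assms that] by (rule abs_cos_diff_le)
    \<comment> \<open>Only the half-index offset survives the subtraction, so the bound is
      independent of \<open>i\<close>.\<close>
    also have "\<dots> = \<bar>- (\<alpha> * (1 / 2) ^ m / 2)\<bar>"
      by (rule arg_cong[where f = abs]) (simp add: field_simps)
    also have "\<dots> \<le> \<alpha> * (1 / 2) ^ m"
      using \<open>0 < \<alpha>\<close> by simp
    finally show ?thesis .
  qed
  have "(\<lambda>m. \<alpha> * (1 / 2) ^ m) \<longlonglongrightarrow> \<alpha> * 0"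
    by (intro tendsto_intros LIMSEQ_power_zero) auto
  then have lim: "(\<lambda>m. ereal (\<alpha> * (1 / 2) ^ m)) \<longlonglongrightarrow> 0"
    by (simp add: zero_ereal_def)
  show "?S \<longlonglongrightarrow> 0"
  proof (rule tendsto_sandwich[OF _ _ tendsto_const lim])
    show "\<forall>\<^sub>F m in sequentially. 0 \<le> ?S m"
      \<comment> \<open>Any index would do; the term at index 0 is already nonnegative.\<close>
      by (intro always_eventually allI SUP_upper2[of 0]) auto
    show "\<forall>\<^sub>F m in sequentially. ?S m \<le> ereal (\<alpha> * (1 / 2) ^ m)"
      using eventually_ge_at_top[of k] by eventually_elim (simp only: SUP_le_iff ereal_less_eq dist simp_thms ball_UNIV)
  qed
qed

theorem proposition6p1:
  fixes \<alpha> :: real and n :: nat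
  assumes "0 < \<alpha>" and "\<alpha> < pi / 3" and "0 < n" and "\<alpha> = 2 * pi / real n"
  shows
    "(\<forall>f k. subdivision_data \<alpha> f \<and> (\<forall>i. f k i = cos ((of_int i - 1 / 2) * (\<alpha> / 2 ^ k))) \<longrightarrow>
       limit_curve f (\<lambda>x. cos (\<alpha> * x)) \<and>
       (\<forall>i::int. 0 \<le> i \<and> i \<le> 2 ^ k * int n \<longrightarrow>
          f (k + 1) (2 * i) = cos ((of_int (2 * i) - 1 / 2) * (\<alpha> / 2 ^ (k + 1))) \<and>
          f (k + 1) (2 * i + 1) = cos ((of_int (2 * i + 1) - 1 / 2) * (\<alpha> / 2 ^ (k + 1))))) \<and>
     (\<forall>f k. subdivision_data \<alpha> f \<and> (\<forall>i. f k i = sin ((of_int i - 1 / 2) * (\<alpha> / 2 ^ k))) \<longrightarrow>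
       limit_curve f (\<lambda>x. sin (\<alpha> * x)) \<and>
       (\<forall>i::int. 0 \<le> i \<and> i \<le> 2 ^ k * int n \<longrightarrow>
          f (k + 1) (2 * i) = sin ((of_int (2 * i) - 1 / 2) * (\<alpha> / 2 ^ (k + 1))) \<and>
          f (k + 1) (2 * i + 1) = sin ((of_int (2 * i + 1) - 1 / 2) * (\<alpha> / 2 ^ (k + 1)))))"
proof -
  have \<alpha>: "0 < \<alpha>" "\<alpha> < pi"
    using assms pi_gt_zero by linarith+
  \<comment> \<open>Rewriting with this turns the sine half of the goal into the instance
    \<open>p = - pi / 2\<close>; the cosine half is \<open>p = 0\<close> after
    \<open>add_0_right\<close>.\<close>
  have sin_cos: "sin x = cos (x + - pi / 2)" for x :: real
    by (simp add: cos_diff)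
  show ?thesis
    unfolding sin_cos
    using limit_curve_cos[OF \<alpha>, where p = 0] subdivision_data_cos_step[OF \<alpha>, where p = 0]
      limit_curve_cos[OF \<alpha>, where p = "- pi / 2"] subdivision_data_cos_step[OF \<alpha>, where p = "- pi / 2"]
    unfolding Suc_eq_plus1 add_0_right by blast
qed

end
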